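(* Let $\gamma_1,\dots,\gamma_r\in M=\mathbb{Z}^n$ and let $c_1,\dots,c_r>0$ be real numbers such that the set $S=\{\xi\in Q:\xi^{\gamma_i}<c_i\ (i=1,\dots,r)\}$ is non-empty, where $Q=(\mathbb{R}_{+}^* )^n\subseteq T(\mathbb{R})$. Put $C_S=\mathrm{cone}(\gamma_1,\dots,\gamma_r)\subseteq M_{\mathbb{R}}$. Let $\sigma$ be a pointed cone in $N_{\mathbb{R}}$, and consider $S$ as a subset of $U_\sigma(\mathbb{R})$. Then the ring $B_{U_\sigma}(S)$ of all regular functions on $U_\sigma$ that are bounded on $S$ is $$B_{U_\sigma}(S)=\mathbb{R}[H],\qquad H=M\cap\sigma^*\cap C_S.$$
   Context: $T$ is the $n$-dimensional split torus over $\mathbb{R}$ with $T(\mathbb{R})=(\mathbb{R}^* )^n$; $M=\mathrm{Hom}(T,\mathbb{G}_m)=\mathbb{Z}^n$ is its character group, $N=\mathrm{Hom}(\mathbb{G}_m,T)=\mathbb{Z}^n$ its co-character group, with natural pairing $\langle\alpha,v\rangle$; $\xi^\alpha=\prod_i\xi_i^{\alpha_i}$. $M_{\mathbb{R}}=M\otimes\mathbb{R}$, $N_{\mathbb{R}}=N\otimes\mathbb{R}$. $Q=(\mathbb{R}_+^* )^n$ is the open positive orthant. A cone in $N_{\mathbb{R}}$ always means a finitely generated rational convex cone; it is pointed if it contains no line. $\sigma^*=\{\alpha\in M_{\mathbb{R}}:\langle\alpha,v\rangle\ge0\ \forall v\in\sigma\}$. $U_\sigma=\mathrm{Spec}\,\mathbb{R}[M\cap\sigma^*]$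 is the affine toric variety of $\sigma$ (spectrum of the semigroup algebra); its dense torus orbit is identified with $T$, so $T(\mathbb{R})\subseteq U_\sigma(\mathbb{R})$. $\mathbb{R}[H]$ denotes the semigroup algebra of $H$, viewed inside $\mathbb{R}[U_\sigma]=\mathbb{R}[M\cap\sigma^*]$. $\mathrm{cone}(\cdot)$ is the convex cone generated. *)

theory Defs
  imports "HOL-Analysis.Analysis" "HOL-Library.Poly_Mapping"
begin

text \<open>
  Both lattices \<open>M\<close> and \<open>N\<close> are \<open>\<int>\<^sup>n\<close>, rendered as \<open>int ^ 'n\<close> with \<open>n = CARD('n)\<close>, and
  \<open>M\<^sub>\<real>\<close>, \<open>N\<^sub>\<real>\<close> are \<open>real ^ 'n\<close>; the pairing between them is the inner product.
\<close>

definition lattice_vec :: "int ^ 'n \<Rightarrow> real ^ 'n" where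
  "lattice_vec a = (\<chi> i. real_of_int (a $ i))"

definition rational_cone :: "(real ^ 'n) set \<Rightarrow> bool" where
  "rational_cone \<sigma> \<longleftrightarrow> (\<exists>V. finite V \<and> \<sigma> = convex_cone hull (lattice_vec ` V))"

definition pointed :: "(real ^ 'n) set \<Rightarrow> bool" where
  "pointed \<sigma> \<longleftrightarrow> \<not> (\<exists>x v. v \<noteq> 0 \<and> (\<forall>t. x + t *\<^sub>R v \<in> \<sigma>))"

definition dual_cone :: "(real ^ 'n) set \<Rightarrow> (real ^ 'n) set" where
  "dual_cone \<sigma> = {\<alpha>. \<forall>v\<in>\<sigma>. 0 \<le> \<alpha> \<bullet> v}"

text \<open>
  The group algebra \<open>\<real>[M]\<close> is the type \<open>(int ^ 'n) \<Rightarrow>\<^sub>0 real\<close> of finitely supported functions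
  with the convolution product; \<open>\<real>[H]\<close> for \<open>H \<subseteq> M\<close> is its subspace spanned by the characters
  in \<open>H\<close>.
\<close>

definition semigroup_algebra :: "(int ^ 'n) set \<Rightarrow> ((int ^ 'n) \<Rightarrow>\<^sub>0 real) set" where
  "semigroup_algebra H = {f. Poly_Mapping.keys f \<subseteq> H}"

definition coordinate_ring :: "(real ^ 'n) set \<Rightarrow> ((int ^ 'n) \<Rightarrow>\<^sub>0 real) set" where
  "coordinate_ring \<sigma> = semigroup_algebra {\<alpha>. lattice_vec \<alpha> \<in> dual_cone \<sigma>}"

text \<open>
  \<open>U\<^sub>\<sigma>\<close> is affine, so its regular functions are the elements of its coordinate ring, its real
  points are the \<open>\<real>\<close>-algebra homomorphisms from the coordinate ring to \<open>\<real>\<close>, and the value of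
  a regular function \<open>f\<close> at the point \<open>p\<close> is \<open>p f\<close>.  Homomorphisms are extensional functions
  (equal to \<open>undefined\<close> off the coordinate ring), so that equal points are equal functions.
\<close>

definition real_points :: "(real ^ 'n) set \<Rightarrow> (((int ^ 'n) \<Rightarrow>\<^sub>0 real) \<Rightarrow> real) set" where
  "real_points \<sigma> = {p \<in> extensional (coordinate_ring \<sigma>).
     (\<forall>a. p (Poly_Mapping.single 0 a) = a) \<and>
     (\<forall>f\<in>coordinate_ring \<sigma>. \<forall>g\<in>coordinate_ring \<sigma>. p (f + g) = p f + p g \<and> p (f * g) = p f * p g)}"

definition torus :: "(real ^ 'n) set" where
  "torus = {\<xi>. \<forall>i. \<xi> $ i \<noteq> 0}"

definition positive_orthant :: "(real ^ 'n) set" where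
  "positive_orthant = {\<xi>. \<forall>i. \<xi> $ i > 0}"

definition character :: "int ^ 'n \<Rightarrow> real ^ 'n \<Rightarrow> real" where
  "character \<alpha> \<xi> = (\<Prod>i\<in>UNIV. \<xi> $ i powi (\<alpha> $ i))"

definition laurent_eval :: "((int ^ 'n) \<Rightarrow>\<^sub>0 real) \<Rightarrow> real ^ 'n \<Rightarrow> real" where
  "laurent_eval f \<xi> = (\<Sum>\<alpha>\<in>Poly_Mapping.keys f. Poly_Mapping.lookup f \<alpha> * character \<alpha> \<xi>)"

text \<open>The inclusion of \<open>T(\<real>)\<close> into \<open>U\<^sub>\<sigma>(\<real>)\<close> sends \<open>\<xi>\<close> to evaluation at \<open>\<xi>\<close>.\<close>

definition torus_point :: "(real ^ 'n) set \<Rightarrow> real ^ 'n \<Rightarrow> ((int ^ 'n) \<Rightarrow>\<^sub>0 real) \<Rightarrow> real" where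
  "torus_point \<sigma> \<xi> = restrict (\<lambda>f. laurent_eval f \<xi>) (coordinate_ring \<sigma>)"

definition bounded_regular_functions ::
  "(real ^ 'n) set \<Rightarrow> (((int ^ 'n) \<Rightarrow>\<^sub>0 real) \<Rightarrow> real) set \<Rightarrow> ((int ^ 'n) \<Rightarrow>\<^sub>0 real) set" where
  "bounded_regular_functions \<sigma> P = {f \<in> coordinate_ring \<sigma>. bounded ((\<lambda>p. p f) ` P)}"

lemma coordinate_ring_add:
  assumes "f \<in> coordinate_ring \<sigma>" "g \<in> coordinate_ring \<sigma>"
  shows "f + g \<in> coordinate_ring \<sigma>"
  using assms Poly_Mapping.keys_add[of f g]
  unfolding coordinate_ring_def semigroup_algebra_def by blast

lemma coordinate_ring_mult:
  assumes "f \<in> coordinate_ring \<sigma>" "g \<in> coordinate_ring \<sigma>"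
  shows "f * g \<in> coordinate_ring \<sigma>"
proof -
  have "lattice_vec (a + b) = lattice_vec a + lattice_vec b" for a b :: "int ^ 'a"
    by (simp add: lattice_vec_def vec_eq_iff)
  hence "lattice_vec (a + b) \<in> dual_cone \<sigma>"
    if "lattice_vec a \<in> dual_cone \<sigma>" "lattice_vec b \<in> dual_cone \<sigma>" for a b
    using that by (simp add: dual_cone_def inner_add_left)
  with assms keys_mult[of f g] show ?thesis
    unfolding coordinate_ring_def semigroup_algebra_def by fastforce
qed

lemma coordinate_ring_const: "Poly_Mapping.single 0 a \<in> coordinate_ring \<sigma>"
proof -
  have "lattice_vec 0 = (0 :: real ^ 'a)"
    by (simp add: lattice_vec_def vec_eq_iff)
  thus ?thesis
    by (auto simp: coordinate_ring_def semigroup_algebra_def dual_cone_def split: if_splits)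
qed

lemma character_add:
  assumes "\<xi> \<in> torus"
  shows "character (\<alpha> + \<beta>) \<xi> = character \<alpha> \<xi> * character \<beta> \<xi>"
  using assms by (simp add: character_def torus_def power_int_add prod.distrib)

lemma laurent_eval_superset:
  assumes "finite A" "Poly_Mapping.keys f \<subseteq> A"
  shows "laurent_eval f \<xi> = (\<Sum>\<alpha>\<in>A. Poly_Mapping.lookup f \<alpha> * character \<alpha> \<xi>)"
  unfolding laurent_eval_def
  using assms by (intro sum.mono_neutral_left) (auto simp: in_keys_iff)

lemma laurent_eval_add: "laurent_eval (f + g) \<xi> = laurent_eval f \<xi> + laurent_eval g \<xi>"
proof -
  let ?A = "Poly_Mapping.keys f \<union> Poly_Mapping.keys g"
  have "finite ?A" "Poly_Mapping.keys (f + g) \<subseteq> ?A"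
    using Poly_Mapping.keys_add[of f g] by auto
  thus ?thesis
    by (simp add: laurent_eval_superset[of ?A] lookup_add distrib_right sum.distrib)
qed

lemma laurent_eval_single: "laurent_eval (Poly_Mapping.single \<alpha> a) \<xi> = a * character \<alpha> \<xi>"
  by (simp add: laurent_eval_superset[of "{\<alpha>}"])

lemma laurent_eval_mult:
  assumes "\<xi> \<in> torus"
  shows "laurent_eval (f * g) \<xi> = laurent_eval f \<xi> * laurent_eval g \<xi>"
proof -
  have zero: "laurent_eval 0 \<xi> = 0"
    by (simp add: laurent_eval_def)
  have upd: "Poly_Mapping.update k v h = h + Poly_Mapping.single k v"
    if "k \<notin> Poly_Mapping.keys h" for k v and h :: "(int ^ 'a) \<Rightarrow>\<^sub>0 real"
    using that
    by (intro poly_mapping_eqI) (auto simp: lookup_update lookup_add lookup_single in_keys_iff)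
  have single: "laurent_eval (Poly_Mapping.single \<alpha> a * g) \<xi> = a * character \<alpha> \<xi> * laurent_eval g \<xi>"
    for \<alpha> a
  proof (induction g rule: update_induct)
    case (update g k v)
    thus ?case
      by (simp add: upd distrib_left laurent_eval_add mult_single laurent_eval_single
          character_add[OF assms])
  qed (simp add: zero)
  show ?thesis
  proof (induction f rule: update_induct)
    case (update f k v)
    thus ?case
      by (simp add: upd distrib_right laurent_eval_add single laurent_eval_single)
  qed (simp add: zero)
qed

lemma torus_point_real_point:
  assumes "\<xi> \<in> torus"
  shows "torus_point \<sigma> \<xi> \<in> real_points \<sigma>"
  using assms
  by (auto simp: real_points_def torus_point_def coordinate_ring_add coordinate_ring_mult
      coordinate_ring_const laurent_eval_add laurent_eval_mult laurent_eval_single character_def)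

lemma positive_orthant_subset_torus: "positive_orthant \<subseteq> torus"
  by (auto simp: positive_orthant_def torus_def less_imp_neq[symmetric])

end

theory Submission
  imports Defs
begin

text \<open>
  In the coordinates \<open>\<xi> = exp x\<close> a Laurent polynomial becomes an exponential sum, and \<open>S\<close> becomes
  the open set of all \<open>x\<close> with \<open>\<gamma>\<^sub>i \<bullet> x < ln c\<^sub>i\<close>, on which every character from \<open>C\<^sub>S\<close> is
  bounded.  Conversely, if \<open>\<alpha> \<notin> C\<^sub>S\<close> occurs in \<open>f\<close>, separate \<open>\<alpha>\<close> from the closed cone \<open>C\<^sub>S\<close> by
  some \<open>w\<close> with \<open>\<alpha> \<bullet> w > 0 \<ge> \<gamma>\<^sub>i \<bullet> w\<close>.  All rays in direction \<open>w\<close> stay in \<open>S\<close>, so if \<open>f\<close> is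
  bounded, its part of maximal \<open>w\<close>-weight must vanish at every starting point, which
  contradicts the linear independence of exponentials on open sets.
\<close>

section \<open>Exponential sums\<close>

text \<open>Induction on \<open>A\<close>: differentiating away one exponent \<open>p\<close> leaves
  a relation over the others with rescaled coefficients, so the induction hypothesis is needed for
  arbitrary \<open>c\<close>.\<close>

lemma exp_inner_linear_independent:
  fixes c :: "'a::real_inner \<Rightarrow> real"
  assumes "finite A" "open U" "U \<noteq> {}"
    and "\<And>x. x \<in> U \<Longrightarrow> (\<Sum>a\<in>A. c a * exp (a \<bullet> x)) = 0"
    and "b \<in> A"
  shows "c b = 0"
  using assms(1,4,5)
proof (induction A arbitrary: c b rule: finite_induct)
  case (insert p A)
  have A: "c b = 0" if b: "b \<in> A" for b
  proof -
    have "(\<Sum>a\<in>A. (c a * ((a - p) \<bullet> (b - p))) * exp (a \<bullet> x)) = 0" if x: "x \<in> U" for x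
    proof -
      \<comment> \<open>Dividing by \<open>exp (p \<bullet> x)\<close> makes the term of \<open>p\<close> constant, so differentiating removes it.\<close>
      let ?h = "\<lambda>t::real. \<Sum>a\<in>insert p A. c a * exp ((a - p) \<bullet> (x + t *\<^sub>R (b - p)))"
      have "open ((\<lambda>t::real. x + t *\<^sub>R (b - p)) -` U)"
        by (intro open_vimage assms continuous_intros)
      moreover have "?h t = 0" if "t \<in> (\<lambda>t::real. x + t *\<^sub>R (b - p)) -` U" for t
      proof -
        let ?y = "x + t *\<^sub>R (b - p)"
        have "?h t = exp (- (p \<bullet> ?y)) * (\<Sum>a\<in>insert p A. c a * exp (a \<bullet> ?y))"
          unfolding sum_distrib_left
          by (intro sum.cong) (simp_all only: inner_diff_left exp_diff exp_minus divide_inverse mult_ac)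
        also have "\<dots> = 0"
          using insert.prems(1)[of ?y] that by simp
        finally show ?thesis .
      qed
      moreover have "0 \<in> (\<lambda>t::real. x + t *\<^sub>R (b - p)) -` U"
        using x by simp
      ultimately have "(?h has_field_derivative 0) (at 0)"
        by (intro has_field_derivative_transform_within_open[OF DERIV_const]) auto
      moreover have "(?h has_field_derivative
          (\<Sum>a\<in>insert p A. c a * (exp ((a - p) \<bullet> x) * ((a - p) \<bullet> (b - p))))) (at 0)"
        unfolding inner_add_right inner_scaleR_right
        by (rule DERIV_sum) (auto intro!: derivative_eq_intros)
      ultimately have "(\<Sum>a\<in>insert p A. c a * (exp ((a - p) \<bullet> x) * ((a - p) \<bullet> (b - p)))) = 0"
        using DERIV_unique by blast
      hence "exp (p \<bullet> x) * (\<Sum>a\<in>A. c a * (exp ((a - p) \<bullet> x) * ((a - p) \<bullet> (b - p)))) = 0"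
        using insert.hyps by simp
      also have "exp (p \<bullet> x) * (\<Sum>a\<in>A. c a * (exp ((a - p) \<bullet> x) * ((a - p) \<bullet> (b - p)))) =
          (\<Sum>a\<in>A. (c a * ((a - p) \<bullet> (b - p))) * exp (a \<bullet> x))"
        unfolding sum_distrib_left
        by (intro sum.cong) (simp_all add: inner_diff_left[of _ _ x] exp_diff)
      finally show ?thesis .
    qed
    \<comment> \<open>The direction \<open>b - p\<close> turns the factor gained by
      \<open>c b\<close> into a squared norm, nonzero since \<open>p\<close> lies outside
      \<open>A\<close>.\<close>
    from insert.IH[OF this b] have "c b * ((b - p) \<bullet> (b - p)) = 0" .
    moreover have "b \<noteq> p"
      using b insert.hyps by auto
    ultimately show ?thesis
      by simp
  qed
  moreover have "c p = 0"
  proof -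
    obtain x where "x \<in> U"
      using assms by auto
    with insert.prems(1)[of x] insert.hyps A show ?thesis
      by simp
  qed
  ultimately show ?case
    using insert.prems by auto
qed auto

text \<open>Scaled by \<open>exp (- (m * t))\<close>, the sum along the ray tends both to 0, by
  boundedness and \<open>0 < m\<close>, and to the leading sum.\<close>

lemma bounded_on_ray_imp_leading_sum_eq_0:
  fixes c :: "'b \<Rightarrow> real" and e :: "'b \<Rightarrow> 'a::real_inner"
  assumes "finite A" "0 < m" "\<And>a. a \<in> A \<Longrightarrow> e a \<bullet> w \<le> m"
    and bound: "\<And>t. 0 \<le> t \<Longrightarrow> \<bar>\<Sum>a\<in>A. c a * exp (e a \<bullet> (x + t *\<^sub>R w))\<bar> \<le> K"
  shows "(\<Sum>a | a \<in> A \<and> e a \<bullet> w = m. c a * exp (e a \<bullet> x)) = 0"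
proof -
  let ?g = "\<lambda>t. \<Sum>a\<in>A. c a * exp (e a \<bullet> (x + t *\<^sub>R w))"
  have decay: "((\<lambda>t::real. exp (- (k * t))) \<longlongrightarrow> 0) at_top" if "0 < k" for k :: real
  proof -
    have "filterlim (\<lambda>t. - (k * t)) at_bot at_top"
      using that
      by (simp add: filterlim_uminus_at_bot filterlim_tendsto_pos_mult_at_top[OF tendsto_const _ filterlim_ident])
    thus ?thesis
      by (rule filterlim_compose[OF exp_at_bot])
  qed
  have "((\<lambda>t. exp (- (m * t)) * ?g t) \<longlongrightarrow> 0) at_top"
  proof (rule tendsto_0_le[OF decay[OF \<open>0 < m\<close>]])
    show "\<forall>\<^sub>F t in at_top. norm (exp (- (m * t)) * ?g t) \<le> norm (exp (- (m * t))) * K"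
      using eventually_ge_at_top[of 0]
      by eventually_elim (simp add: abs_mult bound)
  qed
  \<comment> \<open>After scaling, terms of weight \<open>m\<close> are constant in \<open>t\<close>
    and terms of smaller weight decay.\<close>
  moreover have "((\<lambda>t. exp (- (m * t)) * ?g t) \<longlongrightarrow>
      (\<Sum>a\<in>A. if e a \<bullet> w = m then c a * exp (e a \<bullet> x) else 0)) at_top"
  proof -
    have eq: "exp (- (m * t)) * ?g t =
        (\<Sum>a\<in>A. c a * exp (e a \<bullet> x) * exp (- ((m - e a \<bullet> w) * t)))" for t
      unfolding sum_distrib_left
      by (intro sum.cong) (simp_all add: exp_add[symmetric] algebra_simps inner_add_right)
    have "((\<lambda>t. c a * exp (e a \<bullet> x) * exp (- ((m - e a \<bullet> w) * t))) \<longlongrightarrow>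
        (if e a \<bullet> w = m then c a * exp (e a \<bullet> x) else 0)) at_top" if "a \<in> A" for a
    proof (cases "e a \<bullet> w = m")
      case False
      with assms(3)[OF that] have "0 < m - e a \<bullet> w"
        by simp
      from tendsto_mult_right_zero[OF decay[OF this]] False show ?thesis
        by simp
    qed simp
    thus ?thesis
      unfolding eq by (intro tendsto_sum)
  qed
  ultimately have "(\<Sum>a\<in>A. if e a \<bullet> w = m then c a * exp (e a \<bullet> x) else 0) = 0"
    by (meson tendsto_unique trivial_limit_at_top_linorder)
  thus ?thesis
    by (simp add: sum.inter_filter[OF \<open>finite A\<close>])
qed

section \<open>Linear functionals and finitely generated cones\<close>

text \<open>A finitely generated cone is closed, so a hyperplane strictly separates it from
  \<open>a\<close>; invariance under scaling then gives the sign on the generators.\<close>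

lemma separating_direction_convex_cone_hull:
  fixes a :: "'a::euclidean_space"
  assumes "finite V" "a \<notin> convex_cone hull V"
  obtains w where "0 < a \<bullet> w" "\<And>v. v \<in> V \<Longrightarrow> v \<bullet> w \<le> 0"
proof -
  let ?C = "convex_cone hull V"
  obtain u b where ub: "u \<bullet> a < b" "\<And>x. x \<in> ?C \<Longrightarrow> b < u \<bullet> x"
    using separating_hyperplane_closed_point[OF convex_convex_cone_hull
        closed_convex_cone_hull[OF assms(1)] assms(2)] by blast
  have "b < 0"
    using ub(2)[OF convex_cone_hull_contains_0] by simp
  have "0 \<le> u \<bullet> v" if "v \<in> V" for v
  proof (rule ccontr)
    assume neg: "\<not> 0 \<le> u \<bullet> v"
    \<comment> \<open>The factor is positive, and on this multiple of \<open>v\<close> the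
      functional \<open>u\<close> takes the value \<open>b\<close>, which strict separation
      forbids.\<close>
    have "(b / (u \<bullet> v)) *\<^sub>R v \<in> ?C"
      using neg \<open>b < 0\<close> that
      by (intro convex_cone_scaleR convex_cone_convex_cone_hull hull_inc) (auto simp: divide_nonpos_neg)
    from ub(2)[OF this] neg show False
      by simp
  qed
  with ub(1) \<open>b < 0\<close> show thesis
    by (intro that[of "- u"]) (auto simp: inner_commute)
qed

text \<open>The vectors whose functional is bounded above on \<open>L\<close> form a convex cone, so
  they include the hull once they include \<open>V\<close>.\<close>

lemma bdd_above_inner_convex_cone_hull:
  assumes "a \<in> convex_cone hull V"
    and "\<And>v. v \<in> V \<Longrightarrow> bdd_above ((\<lambda>x. v \<bullet> x) ` L)"
  shows "bdd_above ((\<lambda>x. a \<bullet> x) ` L)"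
proof -
  let ?B = "{v. \<exists>M. \<forall>x\<in>L. v \<bullet> x \<le> M}"
  have "convex_cone ?B"
    unfolding convex_cone_iff
  proof (intro conjI ballI allI impI)
    show "u + v \<in> ?B" if uv: "u \<in> ?B" "v \<in> ?B" for u v
    proof -
      obtain M M' where "\<forall>x\<in>L. u \<bullet> x \<le> M" "\<forall>x\<in>L. v \<bullet> x \<le> M'"
        using uv by blast
      hence "\<forall>x\<in>L. (u + v) \<bullet> x \<le> M + M'"
        by (auto simp: inner_add_left intro: add_mono)
      thus ?thesis
        by blast
    qed
    show "k *\<^sub>R v \<in> ?B" if v: "v \<in> ?B" and "0 \<le> k" for v and k :: real
    proof -
      obtain M where "\<forall>x\<in>L. v \<bullet> x \<le> M"
        using v by blast
      hence "\<forall>x\<in>L. (k *\<^sub>R v) \<bullet> x \<le> k * M"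
        using \<open>0 \<le> k\<close> by (auto intro: mult_left_mono)
      thus ?thesis
        by blast
    qed
  qed auto
  moreover have "V \<subseteq> ?B"
    using assms(2) by (auto simp: bdd_above_def)
  ultimately have "convex_cone hull V \<subseteq> ?B"
    by (intro hull_minimal)
  with assms(1) show ?thesis
    by (auto simp: bdd_above_def)
qed

section \<open>Logarithmic coordinates on the positive orthant\<close>

definition exp_vec :: "real ^ 'n \<Rightarrow> real ^ 'n" where
  "exp_vec x = (\<chi> i. exp (x $ i))"

lemma character_exp_vec: "character \<alpha> (exp_vec x) = exp (lattice_vec \<alpha> \<bullet> x)"
  by (simp add: character_def exp_vec_def exp_power_int lattice_vec_def inner_vec_def exp_sum)

lemma laurent_eval_exp_vec:
  "laurent_eval f (exp_vec x) =
    (\<Sum>\<alpha>\<in>Poly_Mapping.keys f. Poly_Mapping.lookup f \<alpha> * exp (lattice_vec \<alpha> \<bullet> x))"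
  by (simp add: laurent_eval_def character_exp_vec)

lemma positive_orthant_eq: "positive_orthant = range exp_vec"
proof -
  have "\<xi> = exp_vec (\<chi> i. ln (\<xi> $ i))" if "\<xi> \<in> positive_orthant" for \<xi> :: "real ^ 'n"
    using that by (simp add: vec_eq_iff exp_vec_def positive_orthant_def)
  moreover have "range exp_vec \<subseteq> positive_orthant"
    by (auto simp: exp_vec_def positive_orthant_def)
  ultimately show ?thesis
    by blast
qed

lemma inj_lattice_vec: "inj lattice_vec"
  by (auto simp: inj_def lattice_vec_def vec_eq_iff)

section \<open>Bounded regular functions\<close>

theorem corollary2p16:
  fixes \<gamma> :: "nat \<Rightarrow> int ^ 'n" and c :: "nat \<Rightarrow> real" and r :: nat
    and S C\<^sub>S \<sigma> :: "(real ^ 'n) set" and H :: "(int ^ 'n) set"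
  assumes "\<forall>i\<in>{1..r}. c i > 0"
    and "S = {\<xi> \<in> positive_orthant. \<forall>i\<in>{1..r}. character (\<gamma> i) \<xi> < c i}"
    and "S \<noteq> {}"
    and "C\<^sub>S = convex_cone hull (lattice_vec ` \<gamma> ` {1..r})"
    and "rational_cone \<sigma>" and "pointed \<sigma>"
    and "H = {\<alpha>. lattice_vec \<alpha> \<in> dual_cone \<sigma> \<inter> C\<^sub>S}"
  shows "bounded_regular_functions \<sigma> (torus_point \<sigma> ` S) = semigroup_algebra H"
proof -
  \<comment> \<open>\<open>L\<close> is \<open>S\<close> in logarithmic coordinates, an intersection
    of finitely many open half-spaces.\<close>
  define L where "L = {x. \<forall>i\<in>{1..r}. lattice_vec (\<gamma> i) \<bullet> x < ln (c i)}"
  have S: "S = exp_vec ` L"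
  proof -
    have "exp y < c i \<longleftrightarrow> y < ln (c i)" if "i \<in> {1..r}" for i y
      using assms(1) that by (metis exp_less_cancel_iff exp_ln)
    thus ?thesis
      unfolding assms(2) positive_orthant_eq L_def by (auto simp: character_exp_vec)
  qed
  have "open L"
  proof -
    have "L = (\<Inter>i\<in>{1..r}. {x. lattice_vec (\<gamma> i) \<bullet> x < ln (c i)})"
      by (auto simp: L_def)
    thus ?thesis
      by (auto intro!: open_INT open_halfspace_lt)
  qed
  have "L \<noteq> {}"
    using S assms(3) by auto
  \<comment> \<open>The criterion is proved for all Laurent polynomials; the condition from
    \<open>\<sigma>\<close> is added at the end through \<open>coordinate_ring\<close>.\<close>
  have "bounded (laurent_eval f ` S) \<longleftrightarrow> (\<forall>\<alpha>\<in>Poly_Mapping.keys f. lattice_vec \<alpha> \<in> C\<^sub>S)" for f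
  proof
    assume inC: "\<forall>\<alpha>\<in>Poly_Mapping.keys f. lattice_vec \<alpha> \<in> C\<^sub>S"
    have "\<exists>M. \<forall>x\<in>L. lattice_vec \<alpha> \<bullet> x \<le> M" if "\<alpha> \<in> Poly_Mapping.keys f" for \<alpha>
    proof -
      have "bdd_above ((\<lambda>x. lattice_vec \<alpha> \<bullet> x) ` L)"
      proof (rule bdd_above_inner_convex_cone_hull)
        show "lattice_vec \<alpha> \<in> convex_cone hull (lattice_vec ` \<gamma> ` {1..r})"
          using inC that assms(4) by simp
      next
        fix v assume "v \<in> lattice_vec ` \<gamma> ` {1..r}"
        then obtain i where "i \<in> {1..r}" "v = lattice_vec (\<gamma> i)"
          by auto
        thus "bdd_above ((\<lambda>x. v \<bullet> x) ` L)"
          by (intro bdd_aboveI2[of _ _ "ln (c i)"]) (auto simp: L_def intro: less_imp_le)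
      qed
      thus ?thesis
        by (auto simp: bdd_above_def)
    qed
    then obtain M where M: "\<And>\<alpha> x. \<alpha> \<in> Poly_Mapping.keys f \<Longrightarrow> x \<in> L \<Longrightarrow> lattice_vec \<alpha> \<bullet> x \<le> M \<alpha>"
      by metis
    have "\<bar>laurent_eval f (exp_vec x)\<bar> \<le>
        (\<Sum>\<alpha>\<in>Poly_Mapping.keys f. \<bar>Poly_Mapping.lookup f \<alpha>\<bar> * exp (M \<alpha>))" if "x \<in> L" for x
      unfolding laurent_eval_exp_vec using M that
      by (intro order_trans[OF sum_abs] sum_mono) (auto simp: abs_mult intro!: mult_left_mono)
    thus "bounded (laurent_eval f ` S)"
      unfolding S bounded_iff by auto
  next
    assume "bounded (laurent_eval f ` S)"
    then obtain K where K: "\<And>x. x \<in> L \<Longrightarrow> \<bar>laurent_eval f (exp_vec x)\<bar> \<le> K"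
      unfolding S bounded_iff by auto
    show "\<forall>\<alpha>\<in>Poly_Mapping.keys f. lattice_vec \<alpha> \<in> C\<^sub>S"
    proof (rule ccontr)
      assume "\<not> (\<forall>\<alpha>\<in>Poly_Mapping.keys f. lattice_vec \<alpha> \<in> C\<^sub>S)"
      then obtain \<alpha> where \<alpha>: "\<alpha> \<in> Poly_Mapping.keys f" "lattice_vec \<alpha> \<notin> C\<^sub>S"
        by auto
      obtain w where w: "0 < lattice_vec \<alpha> \<bullet> w"
        "\<And>v. v \<in> lattice_vec ` \<gamma> ` {1..r} \<Longrightarrow> v \<bullet> w \<le> 0"
        using \<alpha>(2) separating_direction_convex_cone_hull[of "lattice_vec ` \<gamma> ` {1..r}" "lattice_vec \<alpha>"]
        unfolding assms(4) by auto
      have ray: "x + t *\<^sub>R w \<in> L" if "x \<in> L" "0 \<le> t" for x t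
      proof -
        have "lattice_vec (\<gamma> i) \<bullet> (x + t *\<^sub>R w) < ln (c i)" if "i \<in> {1..r}" for i
        proof -
          have "t * (lattice_vec (\<gamma> i) \<bullet> w) \<le> 0"
            using w(2) \<open>i \<in> {1..r}\<close> \<open>0 \<le> t\<close> by (intro mult_nonneg_nonpos) auto
          moreover have "lattice_vec (\<gamma> i) \<bullet> x < ln (c i)"
            using \<open>x \<in> L\<close> \<open>i \<in> {1..r}\<close> by (simp add: L_def)
          ultimately show ?thesis
            by (simp add: inner_add_right)
        qed
        thus ?thesis
          by (simp add: L_def)
      qed
      \<comment> \<open>\<open>F\<close> holds the exponents of maximal \<open>w\<close>-weight. It
        may miss \<open>\<alpha>\<close>, whose weight serves to make the maximum positive.\<close>
      define W where "W = (\<lambda>\<beta>. lattice_vec \<beta> \<bullet> w) ` Poly_Mapping.keys f"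
      define F where "F = {\<beta> \<in> Poly_Mapping.keys f. lattice_vec \<beta> \<bullet> w = Max W}"
      have W: "finite W" "lattice_vec \<alpha> \<bullet> w \<in> W"
        using \<alpha>(1) by (auto simp: W_def)
      have "0 < Max W"
        using w(1) Max_ge[OF W] by simp
      have "(\<Sum>\<beta>\<in>F. Poly_Mapping.lookup f \<beta> * exp (lattice_vec \<beta> \<bullet> x)) = 0" if "x \<in> L" for x
        unfolding F_def
      proof (rule bounded_on_ray_imp_leading_sum_eq_0)
        show "\<bar>\<Sum>\<beta>\<in>Poly_Mapping.keys f.
            Poly_Mapping.lookup f \<beta> * exp (lattice_vec \<beta> \<bullet> (x + t *\<^sub>R w))\<bar> \<le> K" if "0 \<le> t" for t
          using K[OF ray[OF \<open>x \<in> L\<close> that]] by (simp add: laurent_eval_exp_vec)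
      qed (use \<open>0 < Max W\<close> W in \<open>auto simp: W_def\<close>)
      \<comment> \<open>Linear independence is stated for sums over a set of real vectors, so the
        sum is reindexed along the injective \<open>lattice_vec\<close>.\<close>
      hence sum_0: "(\<Sum>a\<in>lattice_vec ` F. Poly_Mapping.lookup f (inv lattice_vec a) * exp (a \<bullet> x)) = 0"
        if "x \<in> L" for x
        using that by (simp add: sum.reindex[OF inj_on_subset[OF inj_lattice_vec subset_UNIV]]
            inv_f_f[OF inj_lattice_vec])
      have "Poly_Mapping.lookup f (inv lattice_vec a) = 0" if "a \<in> lattice_vec ` F" for a
      proof (rule exp_inner_linear_independent[OF _ \<open>open L\<close> \<open>L \<noteq> {}\<close> _ that])
        show "finite (lattice_vec ` F)"
          by (simp add: F_def)
      qed (rule sum_0)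
      hence "Poly_Mapping.lookup f \<beta> = 0" if "\<beta> \<in> F" for \<beta>
        using that by (metis imageI inv_f_f[OF inj_lattice_vec])
      \<comment> \<open>The maximum is attained, so \<open>F\<close> contains a key of
        \<open>f\<close>, whose coefficient is nonzero.\<close>
      moreover have "Max W \<in> W"
        using W by (intro Max_in) auto
      then obtain \<beta> where "\<beta> \<in> F"
        by (auto simp: W_def F_def)
      ultimately show False
        by (auto simp: F_def in_keys_iff)
    qed
  qed
  \<comment> \<open>Membership in the coordinate ring matters here: elsewhere
    \<open>torus_point\<close> has the default value \<open>undefined\<close>.\<close>
  moreover have "(\<lambda>p. p f) ` torus_point \<sigma> ` S = laurent_eval f ` S" if "f \<in> coordinate_ring \<sigma>" for f
    using that by (simp add: image_image torus_point_def)
  ultimately have "bounded_regular_functions \<sigma> (torus_point \<sigma> ` S) =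
      {f \<in> coordinate_ring \<sigma>. \<forall>\<alpha>\<in>Poly_Mapping.keys f. lattice_vec \<alpha> \<in> C\<^sub>S}"
    by (simp add: bounded_regular_functions_def cong: conj_cong)
  thus ?thesis
    by (auto simp: coordinate_ring_def semigroup_algebra_def assms(7))
qed

end
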